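(* A bornological universe $(X,\mathcal{B})$ is $bb$-uniformizable if and only if it is $tb$-uniformizable.
   Context: A bornology on a set $X$ is a set $\mathcal{B}\subseteq 2^X$ such that $\{x\}\in\mathcal{B}$ for each $x\in X$; $B\in\mathcal{B}$ and $A\subseteq B$ imply $A\in\mathcal{B}$; and $A\cup B\in\mathcal{B}$ whenever $A,B\in\mathcal{B}$. A bornological universe $(X,\mathcal{B})$ is a topological space $X$ endowed with a bornology $\mathcal{B}$ on its underlying set. A subset $B$ of a uniform space $(X,\mathcal{U})$ is bounded in the sense of Bourbaki if for each $U\in\mathcal{U}$ there are $n\in\mathbb{N}$ and a finite set $K\subseteq X$ with $B\subseteq U^n(K)$, where $U^n$ is the $n$-fold composition of $U$. A subset $B$ is totally bounded if for each $U\in\mathcal{U}$ there is a finite partition $(B_i)_{i=1}^n$ of $B$ such that $B_i\times B_i\subseteq U$ for each $i$. Uniform spaces are not assumed to be Hausdorff. $(X,\mathcal{B})$ is $bb$-uniformizable (respectively $tb$-uniformizable) if there is a uniformity $\mathcal{U}$ on $X$ whose underlying topology is the topology of $X$ and such that $\mathcal{B}$ is exactly the set of subsets of $X$ that are bounded in the sense of Bourbaki (respectively totally bounded) for $\mathcal{U}$. *)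

theory Defs
  imports "HOL-Analysis.Abstract_Topology" "HOL-Library.Disjoint_Sets"
begin

definition bornology_on :: "'a set \<Rightarrow> 'a set set \<Rightarrow> bool" where
  "bornology_on X \<B> \<longleftrightarrow>
     \<B> \<subseteq> Pow X \<and>
     (\<forall>x\<in>X. {x} \<in> \<B>) \<and>
     (\<forall>B\<in>\<B>. \<forall>A. A \<subseteq> B \<longrightarrow> A \<in> \<B>) \<and>
     (\<forall>A\<in>\<B>. \<forall>B\<in>\<B>. A \<union> B \<in> \<B>)"

definition bornological_universe :: "'a topology \<Rightarrow> 'a set set \<Rightarrow> bool" where
  "bornological_universe T \<B> \<longleftrightarrow> bornology_on (topspace T) \<B>"

text \<open>
  The type class of uniform spaces in the library fixes a single uniformity on a whole type.
  Here one has to quantify over the uniformities on a given set, so a uniformity is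
  represented by its set of entourages. It need not be Hausdorff.
\<close>

definition is_uniformity :: "'a set \<Rightarrow> ('a \<times> 'a) set set \<Rightarrow> bool" where
  "is_uniformity X \<U> \<longleftrightarrow>
     \<U> \<noteq> {} \<and> \<U> \<subseteq> Pow (X \<times> X) \<and>
     (\<forall>U\<in>\<U>. \<forall>V. U \<subseteq> V \<and> V \<subseteq> X \<times> X \<longrightarrow> V \<in> \<U>) \<and>
     (\<forall>U\<in>\<U>. \<forall>V\<in>\<U>. U \<inter> V \<in> \<U>) \<and>
     (\<forall>U\<in>\<U>. Id_on X \<subseteq> U) \<and>
     (\<forall>U\<in>\<U>. U\<inverse> \<in> \<U>) \<and>
     (\<forall>U\<in>\<U>. \<exists>V\<in>\<U>. V O V \<subseteq> U)"

definition uniform_topology :: "'a set \<Rightarrow> ('a \<times> 'a) set set \<Rightarrow> 'a topology" where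
  "uniform_topology X \<U> = topology (\<lambda>S. S \<subseteq> X \<and> (\<forall>x\<in>S. \<exists>U\<in>\<U>. U `` {x} \<subseteq> S))"

lemma openin_uniform_topology:
  assumes "is_uniformity X \<U>"
  shows "openin (uniform_topology X \<U>) S \<longleftrightarrow> S \<subseteq> X \<and> (\<forall>x\<in>S. \<exists>U\<in>\<U>. U `` {x} \<subseteq> S)"
proof -
  have "istopology (\<lambda>S. S \<subseteq> X \<and> (\<forall>x\<in>S. \<exists>U\<in>\<U>. U `` {x} \<subseteq> S))"
    unfolding istopology_def
  proof (intro conjI allI impI)
    fix S T
    assume S: "S \<subseteq> X \<and> (\<forall>x\<in>S. \<exists>U\<in>\<U>. U `` {x} \<subseteq> S)"
      and T: "T \<subseteq> X \<and> (\<forall>x\<in>T. \<exists>U\<in>\<U>. U `` {x} \<subseteq> T)"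
    show "S \<inter> T \<subseteq> X" using S by blast
    show "\<forall>x\<in>S \<inter> T. \<exists>U\<in>\<U>. U `` {x} \<subseteq> S \<inter> T"
    proof
      fix x assume "x \<in> S \<inter> T"
      then obtain U V where "U \<in> \<U>" "U `` {x} \<subseteq> S" "V \<in> \<U>" "V `` {x} \<subseteq> T"
        using S T by blast
      moreover from this have "U \<inter> V \<in> \<U>"
        using assms by (simp add: is_uniformity_def)
      ultimately show "\<exists>U\<in>\<U>. U `` {x} \<subseteq> S \<inter> T" by blast
    qed
  next
    fix \<K>
    assume *: "\<forall>K\<in>\<K>. K \<subseteq> X \<and> (\<forall>x\<in>K. \<exists>U\<in>\<U>. U `` {x} \<subseteq> K)"
    show "\<Union>\<K> \<subseteq> X" using * by blast
    show "\<forall>x\<in>\<Union>\<K>. \<exists>U\<in>\<U>. U `` {x} \<subseteq> \<Union>\<K>" using * by (meson UnionE Union_upper order_trans)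
  qed
  then show ?thesis by (simp add: uniform_topology_def)
qed

lemma topspace_uniform_topology:
  assumes "is_uniformity X \<U>"
  shows "topspace (uniform_topology X \<U>) = X"
proof -
  have "openin (uniform_topology X \<U>) X"
    using assms unfolding openin_uniform_topology[OF assms] by (fastforce simp: is_uniformity_def)
  then show ?thesis
    using openin_uniform_topology[OF assms] openin_subset openin_topspace by (metis subset_antisym)
qed

definition bourbaki_bounded :: "'a set \<Rightarrow> ('a \<times> 'a) set set \<Rightarrow> 'a set \<Rightarrow> bool" where
  "bourbaki_bounded X \<U> B \<longleftrightarrow>
     B \<subseteq> X \<and> (\<forall>U\<in>\<U>. \<exists>(n::nat) K. finite K \<and> K \<subseteq> X \<and> B \<subseteq> (U ^^ n) `` K)"

definition unif_totally_bounded :: "'a set \<Rightarrow> ('a \<times> 'a) set set \<Rightarrow> 'a set \<Rightarrow> bool" where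
  "unif_totally_bounded X \<U> B \<longleftrightarrow>
     B \<subseteq> X \<and> (\<forall>U\<in>\<U>. \<exists>P. finite P \<and> partition_on B P \<and> (\<forall>C\<in>P. C \<times> C \<subseteq> U))"

definition bb_uniformizable :: "'a topology \<Rightarrow> 'a set set \<Rightarrow> bool" where
  "bb_uniformizable T \<B> \<longleftrightarrow>
     (\<exists>\<U>. is_uniformity (topspace T) \<U> \<and> uniform_topology (topspace T) \<U> = T \<and>
          \<B> = {B. bourbaki_bounded (topspace T) \<U> B})"

definition tb_uniformizable :: "'a topology \<Rightarrow> 'a set set \<Rightarrow> bool" where
  "tb_uniformizable T \<B> \<longleftrightarrow>
     (\<exists>\<U>. is_uniformity (topspace T) \<U> \<and> uniform_topology (topspace T) \<U> = T \<and>
          \<B> = {B. unif_totally_bounded (topspace T) \<U> B})"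

end

theory Submission
  imports Defs "HOL-Analysis.Arcwise_Connected"
begin

text \<open>
  Both notions of uniformizability are equivalent to one condition that mentions no uniformity:
  there is a family \<open>F\<close> of continuous real functions that induces the topology and
  whose members are simultaneously bounded on exactly the sets of the bornology
  (\<open>functionally_determined\<close>).

  Given such a family, both conditions are realized by one and the same uniformity, the weak
  uniformity of \<open>F\<close>. If every function in \<open>F\<close> is bounded on \<open>B\<close>, then
  cutting the values of finitely many of them into short intervals cuts \<open>B\<close> into finitely
  many small pieces, so \<open>B\<close> is totally bounded, hence Bourbaki bounded. And a Bourbaki
  bounded set is reached from a finite set by a bounded number of steps that change a given
  \<open>f \<in> F\<close> by less than 1, so \<open>f\<close> is bounded on it.

  Conversely, for a uniformity whose Bourbaki bounded (or totally bounded) sets are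
  \<open>\<B>\<close>, take all continuous functions that are bounded on every member of
  \<open>\<B>\<close>. They include the bounded functions of Urysohn's lemma, so they induce the
  topology. It remains to find, for a set \<open>A\<close> outside \<open>\<B>\<close>, such a function
  that is unbounded on \<open>A\<close>. Unboundedness of \<open>A\<close> yields a sequence
  \<open>a\<^sub>n\<close> in \<open>A\<close> and an entourage that contains no pair of distinct terms;
  in the Bourbaki case the term \<open>a\<^sub>n\<close> can even be chosen out of reach, in
  \<open>n + 1\<close> steps, of all previous terms. Placing a bump of height \<open>n\<close> on a small
  neighbourhood of each \<open>a\<^sub>n\<close> gives a continuous function because these
  neighbourhoods are uniformly apart, and a member of \<open>\<B>\<close> meets only finitely many
  of them: by the pigeonhole principle, infinitely many would place two distant terms within a
  bounded number of steps of a common point.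
\<close>

section \<open>Entourages\<close>

lemma uniformity_entourage_subset:
  "is_uniformity X \<U> \<Longrightarrow> U \<in> \<U> \<Longrightarrow> U \<subseteq> X \<times> X"
  by (auto simp: is_uniformity_def)

lemma uniformity_refl:
  assumes "is_uniformity X \<U>" "U \<in> \<U>" "x \<in> X"
  shows "(x, x) \<in> U"
proof -
  have "Id_on X \<subseteq> U" using assms by (simp add: is_uniformity_def)
  then show ?thesis using assms(3) by auto
qed

lemma uniformity_inter:
  "is_uniformity X \<U> \<Longrightarrow> U \<in> \<U> \<Longrightarrow> V \<in> \<U> \<Longrightarrow> U \<inter> V \<in> \<U>"
  by (auto simp: is_uniformity_def)

lemma uniformity_converse:
  "is_uniformity X \<U> \<Longrightarrow> U \<in> \<U> \<Longrightarrow> U\<inverse> \<in> \<U>"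
  by (auto simp: is_uniformity_def)

lemma uniformity_root:
  assumes "is_uniformity X \<U>" "U \<in> \<U>"
  obtains V where "V \<in> \<U>" "V O V \<subseteq> U"
proof -
  have "\<exists>V\<in>\<U>. V O V \<subseteq> U" using assms by (simp add: is_uniformity_def)
  then show thesis using that by auto
qed

lemma uniformity_symmetric_root:
  assumes "is_uniformity X \<U>" "U \<in> \<U>"
  obtains W where "W \<in> \<U>" "sym W" "W \<subseteq> U" "W O W \<subseteq> U"
proof -
  obtain V where V: "V \<in> \<U>" "V O V \<subseteq> U"
    using uniformity_root[OF assms] .
  define W where "W = V \<inter> V\<inverse>"
  have W: "W \<in> \<U>"
    unfolding W_def using V assms uniformity_inter uniformity_converse by metis
  have "W \<subseteq> W O W"
    using uniformity_refl[OF assms(1) W] uniformity_entourage_subset[OF assms(1) W] by blast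
  moreover have "W O W \<subseteq> U"
    using V(2) by (auto simp: W_def)
  ultimately show thesis
    using that[of W] W by (auto simp: W_def sym_def)
qed

lemma uniformity_symmetric_fourth_root:
  assumes "is_uniformity X \<U>" "U \<in> \<U>"
  obtains W where "W \<in> \<U>" "sym W" "W \<subseteq> U" "W O W O W O W \<subseteq> U"
proof -
  obtain V where V: "V \<in> \<U>" "V \<subseteq> U" "V O V \<subseteq> U"
    by (rule uniformity_symmetric_root[OF assms]) blast
  obtain W where W: "W \<in> \<U>" "sym W" "W \<subseteq> V" "W O W \<subseteq> V"
    by (rule uniformity_symmetric_root[OF assms(1) V(1)]) blast
  have "W O W O W O W \<subseteq> U"
    using relcomp_mono[OF W(4) W(4)] V(3) by (simp only: O_assoc)
  then show thesis
    using that[of W] W V by blast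
qed

lemma relpow_subset_relpow:
  fixes V U :: "('a \<times> 'a) set"
  assumes "V \<subseteq> U"
  shows "V ^^ n \<subseteq> U ^^ n"
  by (induction n) (use assms in \<open>auto intro: relcomp_mono\<close>)

lemma sym_relpow:
  fixes U :: "('a \<times> 'a) set"
  assumes "sym U"
  shows "sym (U ^^ n)"
proof (induction n)
  case (Suc n)
  show ?case
  proof (rule symI)
    fix x y assume "(x, y) \<in> U ^^ Suc n"
    then obtain z where "(x, z) \<in> U ^^ n" "(z, y) \<in> U" by auto
    then have "(z, x) \<in> U ^^ n" "(y, z) \<in> U"
      using Suc assms by (auto dest: symD)
    then show "(y, x) \<in> U ^^ Suc n" by (rule relpow_Suc_I2[rotated])
  qed
qed (auto simp: sym_def)

lemma relpow_increasing:
  fixes U :: "('a \<times> 'a) set"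
  assumes "\<And>x. x \<in> X \<Longrightarrow> (x, x) \<in> U" and "(x, y) \<in> U ^^ m" "m \<le> n" "y \<in> X"
  shows "(x, y) \<in> U ^^ n"
  using \<open>m \<le> n\<close>
proof (induction n rule: dec_induct)
  case (step n)
  show ?case using relpow_Suc_I[OF step.IH] assms(1)[OF assms(4)] .
qed (rule assms(2))

section \<open>Continuous functions on a uniform space\<close>

lemma continuous_map_uniform_topology_iff:
  fixes f :: "'a \<Rightarrow> real"
  assumes "is_uniformity X \<U>"
  shows "continuous_map (uniform_topology X \<U>) euclideanreal f \<longleftrightarrow>
    (\<forall>x\<in>X. \<forall>\<epsilon>>0. \<exists>U\<in>\<U>. \<forall>y. (x, y) \<in> U \<longrightarrow> \<bar>f y - f x\<bar> < \<epsilon>)" (is "?L \<longleftrightarrow> ?R")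
proof
  assume L: ?L
  show ?R
  proof (intro ballI allI impI)
    fix x \<epsilon> assume x: "x \<in> X" "(\<epsilon>::real) > 0"
    have "openin (uniform_topology X \<U>) {y \<in> topspace (uniform_topology X \<U>). f y \<in> ball (f x) \<epsilon>}"
      by (rule openin_continuous_map_preimage[OF L]) auto
    moreover have "x \<in> {y \<in> topspace (uniform_topology X \<U>). f y \<in> ball (f x) \<epsilon>}"
      using x by (simp add: topspace_uniform_topology[OF assms])
    ultimately obtain U where "U \<in> \<U>" "U `` {x} \<subseteq> {y \<in> topspace (uniform_topology X \<U>). f y \<in> ball (f x) \<epsilon>}"
      unfolding openin_uniform_topology[OF assms] by meson
    then show "\<exists>U\<in>\<U>. \<forall>y. (x, y) \<in> U \<longrightarrow> \<bar>f y - f x\<bar> < \<epsilon>"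
      by (intro bexI[of _ U]) (auto simp: dist_real_def abs_minus_commute)
  qed
next
  assume R: ?R
  have "\<exists>U\<in>\<U>. U `` {x} \<subseteq> {y \<in> X. a < f y}" if "x \<in> X" "a < f x" for x a
  proof -
    have "f x - a > 0" using that by simp
    with R that obtain U where U: "U \<in> \<U>" "\<forall>y. (x, y) \<in> U \<longrightarrow> \<bar>f y - f x\<bar> < f x - a" by meson
    have "a < f y" if "(x, y) \<in> U" for y
      using U(2)[rule_format, OF that] by linarith
    then show ?thesis
      using U(1) uniformity_entourage_subset[OF assms U(1)] by blast
  qed
  moreover have "\<exists>U\<in>\<U>. U `` {x} \<subseteq> {y \<in> X. f y < a}" if "x \<in> X" "f x < a" for x a
  proof -
    have "a - f x > 0" using that by simp
    with R that obtain U where U: "U \<in> \<U>" "\<forall>y. (x, y) \<in> U \<longrightarrow> \<bar>f y - f x\<bar> < a - f x" by meson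
    have "f y < a" if "(x, y) \<in> U" for y
      using U(2)[rule_format, OF that] by linarith
    then show ?thesis
      using U(1) uniformity_entourage_subset[OF assms U(1)] by blast
  qed
  ultimately show ?L
    unfolding continuous_map_upper_lower_semicontinuous_lt openin_uniform_topology[OF assms]
      topspace_uniform_topology[OF assms] by auto
qed

lemma dyadic_strictly_between:
  fixes a b :: real
  assumes "0 \<le> a" "a < b" "b \<le> 1"
  obtains r where "r \<in> dyadics \<inter> {0..1}" "a < r" "r < b"
proof -
  obtain n q r where *: "of_nat q / 2 ^ n \<le> a" "a < of_nat r / 2 ^ n"
      "\<bar>real q / 2 ^ n - real r / 2 ^ n\<bar> < b - a"
    using padic_rational_approximation_straddle_pos_le[of "b - a" 2 a] assms by (metis diff_gt_0_iff_gt one_less_numeral_iff semiring_norm(76))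
  then have "real r / 2 ^ n < b" by linarith
  moreover have "real r / 2 ^ n \<in> dyadics"
    by (auto simp: dyadics_def)
  moreover have "0 \<le> real r / 2 ^ n" by simp
  ultimately show thesis
    using that[of "real r / 2 ^ n"] *(2) assms(3) by (simp del: divide_le_eq_1 divide_le_eq_1_pos)
qed

text \<open>
  This is the proof of the classical Urysohn lemma, with ``some entourage \<open>U\<close> satisfies
  \<open>U[A] \<subseteq> B\<close>'' in the place of ``the closure of \<open>A\<close> lies in the
  interior of \<open>B\<close>''. Square roots of entourages replace normality when a set is
  interpolated between \<open>A\<close> and \<open>B\<close>.
\<close>

lemma uniform_Urysohn:
  assumes unif: "is_uniformity X \<U>" and V: "V \<in> \<U>" and S: "S \<subseteq> X"
  obtains f :: "'a \<Rightarrow> real"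
  where "continuous_map (uniform_topology X \<U>) euclideanreal f"
    "\<And>x. 0 \<le> f x" "\<And>x. f x \<le> 1" "\<And>x. x \<in> S \<Longrightarrow> f x = 0" "\<And>x. x \<notin> V `` S \<Longrightarrow> f x = 1"
proof -
  define R where "R = (\<lambda>A B. A \<subseteq> X \<and> B \<subseteq> X \<and> (\<exists>U\<in>\<U>. U `` A \<subseteq> B))"
  have sub: "A \<subseteq> U `` A" if "U \<in> \<U>" "A \<subseteq> X" for U A
    using uniformity_refl[OF unif] that by blast
  have "R S (V `` S)"
    using V S uniformity_entourage_subset[OF unif V] unfolding R_def by blast
  moreover have "\<exists>C. R A C \<and> R C B" if AB: "R A B" for A B
  proof -
    obtain U where U: "A \<subseteq> X" "B \<subseteq> X" "U \<in> \<U>" "U `` A \<subseteq> B"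
      using AB unfolding R_def by blast
    obtain W where W: "W \<in> \<U>" "W O W \<subseteq> U"
      using uniformity_root[OF unif U(3)] .
    then have "W `` (W `` A) \<subseteq> B" using U(4) by blast
    then have "R A (W `` A)" "R (W `` A) B"
      using W U uniformity_entourage_subset[OF unif W(1)] unfolding R_def by blast+
    then show ?thesis by blast
  qed
  moreover have "R A C" if "R A B" "R B C" for A B C
    using that sub unfolding R_def by (meson order_trans)
  ultimately have "\<exists>G :: real \<Rightarrow> 'a set. G 0 = S \<and> G 1 = V `` S \<and>
      (\<forall>r \<in> dyadics \<inter> {0..1}. \<forall>s \<in> dyadics \<inter> {0..1}. r < s \<longrightarrow> R (G r) (G s))"
    by (rule recursion_on_dyadic_fractions)
  then obtain G :: "real \<Rightarrow> 'a set" where G0: "G 0 = S" and G1: "G 1 = V `` S"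
    and G: "\<And>r s. r \<in> dyadics \<inter> {0..1} \<Longrightarrow> s \<in> dyadics \<inter> {0..1} \<Longrightarrow> r < s \<Longrightarrow> R (G r) (G s)"
    by auto
  \<comment> \<open>The inserted 1 gives points outside all the sets \<open>G r\<close> the value 1.\<close>
  define f where "f x = Inf (insert 1 {r. r \<in> dyadics \<inter> {0..1} \<and> x \<in> G r})" for x
  have bdd: "bdd_below (insert 1 {r. r \<in> dyadics \<inter> {0..1::real} \<and> x \<in> G r})" for x
    by (rule bdd_belowI[of _ 0]) auto
  have f0: "0 \<le> f x" for x
    unfolding f_def by (rule cInf_greatest) auto
  have f1: "f x \<le> 1" for x
    unfolding f_def by (rule cInf_lower[OF _ bdd]) auto
  have f_le: "f x \<le> r" if "r \<in> dyadics \<inter> {0..1}" "x \<in> G r" for x r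
    unfolding f_def by (rule cInf_lower[OF _ bdd]) (use that in auto)
  have f_ge: "r \<le> f x" if "r \<in> dyadics \<inter> {0..1}" "x \<notin> G r" for x r
    unfolding f_def
  proof (rule cInf_greatest)
    fix s assume "s \<in> insert 1 {r. r \<in> dyadics \<inter> {0..1} \<and> x \<in> G r}"
    then consider "s = 1" | "s \<in> dyadics \<inter> {0..1}" "x \<in> G s" by auto
    then show "r \<le> s"
    proof cases
      case 2
      show ?thesis
      proof (rule ccontr)
        assume "\<not> r \<le> s"
        then have "R (G s) (G r)" using G 2 that by auto
        then have "G s \<subseteq> G r" unfolding R_def using sub by blast
        then show False using 2 that by blast
      qed
    qed (use that in auto)
  qed auto
  have "\<exists>U\<in>\<U>. \<forall>y. (x, y) \<in> U \<longrightarrow> \<bar>f y - f x\<bar> < \<epsilon>" if "x \<in> X" "\<epsilon> > 0" for x \<epsilon>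
  proof -
    have "\<exists>U\<in>\<U>. \<forall>y. (x, y) \<in> U \<longrightarrow> f y < f x + \<epsilon>"
    proof (cases "f x + \<epsilon> \<le> 1")
      case True
      obtain r where r: "r \<in> dyadics \<inter> {0..1}" "f x < r" "r < f x + \<epsilon>"
        using dyadic_strictly_between[of "f x" "f x + \<epsilon>"] True f0 \<open>\<epsilon> > 0\<close> by auto
      \<comment> \<open>Two levels are needed: \<open>x\<close> lies in \<open>G r\<close>, and its neighbours only in \<open>G s\<close>.\<close>
      obtain s where s: "s \<in> dyadics \<inter> {0..1}" "r < s" "s < f x + \<epsilon>"
        using dyadic_strictly_between[of r "f x + \<epsilon>"] True r by auto
      obtain U where U: "U \<in> \<U>" "U `` G r \<subseteq> G s"
        using G[OF r(1) s(1,2)] unfolding R_def by blast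
      have "x \<in> G r" using f_ge[of r x] r by force
      then have "f y \<le> s" if "(x, y) \<in> U" for y using f_le[OF s(1)] U(2) that by blast
      then show ?thesis using U(1) s(3) by (meson le_less_trans)
    next
      case False
      have "f y < f x + \<epsilon>" for y using f1[of y] False by linarith
      then show ?thesis using V by blast
    qed
    then obtain U where U: "U \<in> \<U>" "\<And>y. (x, y) \<in> U \<Longrightarrow> f y < f x + \<epsilon>" by blast
    have "\<exists>U\<in>\<U>. \<forall>y. (x, y) \<in> U \<longrightarrow> f x - \<epsilon> < f y"
    proof (cases "f x - \<epsilon> \<ge> 0")
      case True
      obtain r where r: "r \<in> dyadics \<inter> {0..1}" "f x - \<epsilon> < r" "r < f x"
        using dyadic_strictly_between[of "f x - \<epsilon>" "f x"] True f1 \<open>\<epsilon> > 0\<close> by auto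
      obtain s where s: "s \<in> dyadics \<inter> {0..1}" "r < s" "s < f x"
        using dyadic_strictly_between[of r "f x"] f1 r by auto
      obtain U where U: "U \<in> \<U>" "U `` G r \<subseteq> G s"
        using G[OF r(1) s(1,2)] unfolding R_def by blast
      have "x \<notin> G s" using f_le[of s x] s by force
      then have "r \<le> f y" if "(x, y) \<in> U\<inverse>" for y using f_ge[OF r(1)] U(2) that by blast
      then show ?thesis using uniformity_converse[OF unif U(1)] r(2) by (meson less_le_trans)
    next
      case False
      have "f x - \<epsilon> < f y" for y using f0[of y] False by linarith
      then show ?thesis using V by blast
    qed
    then obtain U' where U': "U' \<in> \<U>" "\<And>y. (x, y) \<in> U' \<Longrightarrow> f x - \<epsilon> < f y" by blast
    show ?thesis
    proof (intro bexI allI impI)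
      fix y assume "(x, y) \<in> U \<inter> U'"
      then show "\<bar>f y - f x\<bar> < \<epsilon>" using U(2)[of y] U'(2)[of y] by auto
    qed (rule uniformity_inter[OF unif U(1) U'(1)])
  qed
  then have "continuous_map (uniform_topology X \<U>) euclideanreal f"
    unfolding continuous_map_uniform_topology_iff[OF unif] by blast
  moreover have "f x = 0" if "x \<in> S" for x
    using f_le[of 0 x] f0[of x] G0 that real_in_dyadics[of 0] by simp
  moreover have "f x = 1" if "x \<notin> V `` S" for x
    using f_ge[of 1 x] f1[of x] G1 that real_in_dyadics[of 1] by simp
  ultimately show thesis
    using that f0 f1 by blast
qed

text \<open>
  The function is a sum of bumps of height \<open>n\<close> supported in \<open>W[a\<^sub>n]\<close>. The
  fourfold composition in the hypothesis makes these supports so far apart that each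
  \<open>W[x]\<close> meets at most one of them: two supports met by \<open>W[x]\<close> would link their
  centres through four \<open>W\<close>-steps. So around every point the function agrees with a single
  bump, and it is continuous.
\<close>

lemma separated_sequence_unbounded_function:
  fixes a :: "nat \<Rightarrow> 'a"
  assumes unif: "is_uniformity X \<U>" and W: "W \<in> \<U>" "sym W"
    and aX: "\<And>n. a n \<in> X"
    and sep: "\<And>i j. i \<noteq> j \<Longrightarrow> (a i, a j) \<notin> W O W O W O W"
  obtains f :: "'a \<Rightarrow> real"
  where "continuous_map (uniform_topology X \<U>) euclideanreal f" "\<And>n. f (a n) = real n"
    "\<And>B. finite {n. W `` {a n} \<inter> B \<noteq> {}} \<Longrightarrow> bounded (f ` B)"
proof -
  have "\<exists>g. continuous_map (uniform_topology X \<U>) euclideanreal g \<and> (\<forall>x. 0 \<le> g x \<and> g x \<le> real n) \<and>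
      g (a n) = real n \<and> (\<forall>x. (a n, x) \<notin> W \<longrightarrow> g x = 0)" for n
  proof -
    obtain h where h: "continuous_map (uniform_topology X \<U>) euclideanreal h"
        "\<And>x. 0 \<le> h x" "\<And>x. h x \<le> 1" "\<And>x. x \<in> {a n} \<Longrightarrow> h x = (0::real)" "\<And>x. x \<notin> W `` {a n} \<Longrightarrow> h x = 1"
      using uniform_Urysohn[OF unif W(1), of "{a n}"] aX by blast
    have "continuous_map (uniform_topology X \<U>) euclideanreal (\<lambda>x. real n * (1 - h x))"
      using h(1) by (intro continuous_intros)
    moreover have "0 \<le> real n * (1 - h x)" "real n * (1 - h x) \<le> real n" for x
      using h(2,3)[of x] by (auto simp: mult_left_le)
    ultimately show ?thesis using h(4,5) by (intro exI[of _ "\<lambda>x. real n * (1 - h x)"]) auto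
  qed
  then obtain g where g: "\<And>n. continuous_map (uniform_topology X \<U>) euclideanreal (g n)"
      "\<And>n x. 0 \<le> g n x" "\<And>n x. g n x \<le> real n" "\<And>n. g n (a n) = real n"
      "\<And>n x. (a n, x) \<notin> W \<Longrightarrow> g n x = 0"
    by metis
  define f where "f x = (if \<exists>n. (a n, x) \<in> W then g (SOME n. (a n, x) \<in> W) x else 0)" for x
  have near: "m = n" if "(a m, y) \<in> W" "(x, y) \<in> W" "(x, z) \<in> W" "(a n, z) \<in> W" for m n x y z
  proof (rule ccontr)
    assume "m \<noteq> n"
    moreover have "(a m, a n) \<in> W O W O W O W"
      using that symD[OF W(2)] by blast
    ultimately show False using sep by blast
  qed
  have refl: "(x, x) \<in> W" if "x \<in> X" for x using uniformity_refl[OF unif W(1) that] .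
  have WX: "x \<in> X" "y \<in> X" if "(x, y) \<in> W" for x y
    using uniformity_entourage_subset[OF unif W(1)] that by auto
  have f_eq: "f y = g n y" if "(a n, y) \<in> W" for n y
  proof -
    have "(a (SOME n. (a n, y) \<in> W), y) \<in> W" using that by (rule someI)
    then have "(SOME n. (a n, y) \<in> W) = n"
      using near[OF _ _ _ that, of _ y y] refl WX that by blast
    then show ?thesis using that by (auto simp: f_def)
  qed
  \<comment> \<open>A point near no support also falls under this: the bump \<open>g 0\<close> of height 0 vanishes.\<close>
  have local_form: "\<exists>n. \<forall>y. (x, y) \<in> W \<longrightarrow> f y = g n y" for x
  proof (cases "\<exists>n z. (x, z) \<in> W \<and> (a n, z) \<in> W")
    case True
    then obtain n z where z: "(x, z) \<in> W" "(a n, z) \<in> W" by blast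
    have "f y = g n y" if y: "(x, y) \<in> W" for y
    proof (cases "\<exists>m. (a m, y) \<in> W")
      case True
      then show ?thesis using near[OF _ y z] f_eq by blast
    next
      case False
      then show ?thesis using g(5) by (auto simp: f_def)
    qed
    then show ?thesis by blast
  next
    case False
    have "f y = g 0 y" if "(x, y) \<in> W" for y
      using False that g(2,3)[of 0 y] by (auto simp: f_def)
    then show ?thesis by blast
  qed
  have "\<exists>U\<in>\<U>. \<forall>y. (x, y) \<in> U \<longrightarrow> \<bar>f y - f x\<bar> < \<epsilon>" if x: "x \<in> X" "\<epsilon> > 0" for x \<epsilon>
  proof -
    obtain n where n: "\<And>y. (x, y) \<in> W \<Longrightarrow> f y = g n y" using local_form by blast
    obtain U where U: "U \<in> \<U>" "\<And>y. (x, y) \<in> U \<Longrightarrow> \<bar>g n y - g n x\<bar> < \<epsilon>"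
      using g(1)[of n] x unfolding continuous_map_uniform_topology_iff[OF unif] by blast
    show ?thesis
      by (rule bexI[OF _ uniformity_inter[OF unif U(1) W(1)]])
        (use U(2) n refl[OF x(1)] in auto)
  qed
  then have "continuous_map (uniform_topology X \<U>) euclideanreal f"
    unfolding continuous_map_uniform_topology_iff[OF unif] by blast
  moreover have "f (a n) = real n" for n
    using f_eq[of n "a n"] refl aX g(4) by simp
  moreover have "bounded (f ` B)" if fin: "finite {n. W `` {a n} \<inter> B \<noteq> {}}" for B
  proof -
    obtain N where N: "\<And>n. W `` {a n} \<inter> B \<noteq> {} \<Longrightarrow> n \<le> N"
      using fin by (meson finite_nat_set_iff_bounded_le mem_Collect_eq)
    have "\<bar>f y\<bar> \<le> real N" if "y \<in> B" for y
    proof (cases "\<exists>n. (a n, y) \<in> W")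
      case True
      then obtain n where n: "(a n, y) \<in> W" by blast
      then have "n \<le> N" using N[of n] that by blast
      then show ?thesis using f_eq[OF n] g(2,3)[of n y] by simp
    next
      case False
      then show ?thesis by (simp add: f_def)
    qed
    then show ?thesis by (intro boundedI[of _ "real N"]) auto
  qed
  ultimately show thesis using that by blast
qed

section \<open>Sets that are not bounded\<close>

text \<open>
  A set that is not covered from finitely many of its points contains a sequence each of whose terms
  is missed by all previous ones. The relation may depend on the index, so that for Bourbaki
  boundedness the terms can escape ever longer chains of steps.
\<close>

lemma escaping_sequence:
  fixes R :: "nat \<Rightarrow> ('a \<times> 'a) set"
  assumes "\<And>n K. finite K \<Longrightarrow> K \<subseteq> A \<Longrightarrow> \<not> A \<subseteq> R n `` K"
  shows "\<exists>a. \<forall>n::nat. a n \<in> A \<and> (\<forall>i<n. (a i, a n) \<notin> R n)"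
proof (rule dependent_wellorder_choice)
  fix n :: nat and a
  assume "\<And>m. m < n \<Longrightarrow> a m \<in> A \<and> (\<forall>i<m. (a i, a m) \<notin> R m)"
  then have "a ` {..<n} \<subseteq> A" by auto
  then obtain x where "x \<in> A" "x \<notin> R n `` (a ` {..<n})"
    using assms[of "a ` {..<n}" n] by blast
  then show "\<exists>x. x \<in> A \<and> (\<forall>i<n. (a i, x) \<notin> R n)" by blast
qed auto

text \<open>
  If infinitely many of the sets \<open>W[a\<^sub>n]\<close> met \<open>B\<close>, then two late terms
  would reach \<open>B\<close> at points covered by the same element of the finite set \<open>K\<close>.
\<close>

lemma finitely_many_meet:
  fixes a :: "nat \<Rightarrow> 'a"
  assumes K: "finite K" "B \<subseteq> R `` K"
    and far: "\<And>i j. N \<le> i \<Longrightarrow> i < j \<Longrightarrow> (a i, a j) \<notin> W O R\<inverse> O R O W\<inverse>"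
  shows "finite {n. W `` {a n} \<inter> B \<noteq> {}}"
proof (rule ccontr)
  let ?I = "{n. W `` {a n} \<inter> B \<noteq> {}}"
  assume inf: "\<not> finite ?I"
  have "\<exists>k. n \<in> ?I \<longrightarrow> k \<in> K \<and> (\<exists>b. (a n, b) \<in> W \<and> (k, b) \<in> R)" for n
    using K(2) by fastforce
  then obtain k where k: "\<And>n. n \<in> ?I \<Longrightarrow> k n \<in> K \<and> (\<exists>b. (a n, b) \<in> W \<and> (k n, b) \<in> R)"
    by metis
  have "finite (k ` ?I)" using k K(1) by (auto intro: finite_subset)
  then obtain n0 where J: "infinite {n \<in> ?I. k n = k n0}"
    using pigeonhole_infinite[OF inf] by blast
  obtain i where i: "N \<le> i" "i \<in> ?I" "k i = k n0"
    using J unfolding infinite_nat_iff_unbounded_le by blast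
  obtain j where j: "i < j" "j \<in> ?I" "k j = k n0"
    using J unfolding infinite_nat_iff_unbounded by blast
  have "(a i, a j) \<in> W O R\<inverse> O R O W\<inverse>"
    using k[OF i(2)] k[OF j(2)] i(3) j(3) by auto
  with far i j show False by blast
qed

lemma finite_partition_by_function:
  assumes "finite (h ` B)" and "\<And>x y. x \<in> B \<Longrightarrow> y \<in> B \<Longrightarrow> h x = h y \<Longrightarrow> (x, y) \<in> U"
  shows "\<exists>P. finite P \<and> partition_on B P \<and> (\<forall>C\<in>P. C \<times> C \<subseteq> U)"
proof -
  let ?P = "(\<lambda>k. {x \<in> B. h x = k}) ` h ` B"
  have "partition_on B ?P"
    by (rule partition_onI) (auto simp: disjnt_def)
  then show ?thesis using assms by (intro exI[of _ ?P]) auto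
qed

text \<open>
  In this form total boundedness is Bourbaki boundedness with a single step allowed, and its failure
  has the shape required by \<open>escaping_sequence\<close>.
\<close>

lemma totally_bounded_iff_finite_cover:
  assumes unif: "is_uniformity X \<U>"
  shows "unif_totally_bounded X \<U> B \<longleftrightarrow>
    B \<subseteq> X \<and> (\<forall>U\<in>\<U>. \<exists>K. finite K \<and> K \<subseteq> X \<and> B \<subseteq> U `` K)" (is "?L \<longleftrightarrow> ?R")
proof
  assume L: ?L
  have "\<exists>K. finite K \<and> K \<subseteq> X \<and> B \<subseteq> U `` K" if "U \<in> \<U>" for U
  proof -
    obtain P where P: "finite P" "partition_on B P" "\<forall>C\<in>P. C \<times> C \<subseteq> U"
      using L \<open>U \<in> \<U>\<close> unfolding unif_totally_bounded_def by meson
    have some: "(SOME x. x \<in> C) \<in> C" if "C \<in> P" for C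
      using partition_onD3[OF P(2)] that some_in_eq[of C] by auto
    let ?K = "(\<lambda>C. SOME x. x \<in> C) ` P"
    have "?K \<subseteq> B"
      using some partition_onD1[OF P(2)] by auto
    then have "?K \<subseteq> X" using L unfolding unif_totally_bounded_def by auto
    moreover have "B \<subseteq> U `` ?K"
    proof
      fix x assume "x \<in> B"
      then obtain C where "C \<in> P" "x \<in> C" using partition_onD1[OF P(2)] by auto
      then have "((SOME x. x \<in> C), x) \<in> U" using some P(3) by auto
      then show "x \<in> U `` ?K" using \<open>C \<in> P\<close> by auto
    qed
    ultimately show ?thesis
      using P(1) by (intro exI[of _ ?K]) auto
  qed
  then show ?R using L by (auto simp: unif_totally_bounded_def)
next
  assume R: ?R
  have "\<exists>P. finite P \<and> partition_on B P \<and> (\<forall>C\<in>P. C \<times> C \<subseteq> U)" if "U \<in> \<U>" for U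
  proof -
    obtain W where W: "W \<in> \<U>" "sym W" "W O W \<subseteq> U"
      by (rule uniformity_symmetric_root[OF unif \<open>U \<in> \<U>\<close>]) blast
    obtain K where K: "finite K" "B \<subseteq> W `` K" using R W(1) by meson
    then have "\<forall>x\<in>B. \<exists>k. k \<in> K \<and> (k, x) \<in> W" by blast
    then obtain h where h: "\<And>x. x \<in> B \<Longrightarrow> h x \<in> K \<and> (h x, x) \<in> W"
      by metis
    show ?thesis
    proof (rule finite_partition_by_function)
      show "finite (h ` B)" using h K(1) by (auto intro: finite_subset)
      fix x y assume "x \<in> B" "y \<in> B" "h x = h y"
      then have "(x, h x) \<in> W" "(h x, y) \<in> W" using h symD[OF W(2)] by metis+
      then show "(x, y) \<in> U" using W(3) by blast
    qed
  qed
  then show ?L using R by (auto simp: unif_totally_bounded_def)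
qed

lemma not_bounded_image_if_values_nat:
  fixes a :: "nat \<Rightarrow> 'a" and f :: "'a \<Rightarrow> real"
  assumes "\<And>n. a n \<in> A" and "\<And>n. f (a n) = real n"
  shows "\<not> bounded (f ` A)"
proof
  assume "bounded (f ` A)"
  then obtain c where c: "\<And>x. x \<in> A \<Longrightarrow> \<bar>f x\<bar> \<le> c"
    unfolding bounded_iff by auto
  have "real n \<le> c" for n
    using c[OF assms(1)[of n]] assms(2)[of n] by simp
  then show False
    using reals_Archimedean2[of c] by (meson not_le)
qed

text \<open>
  Terms of the escaping sequence are pairwise separated by one fixed entourage, so a set covered
  by finitely many much smaller pieces meets few of the bumps.
\<close>

lemma unbounded_function_if_not_totally_bounded:
  assumes unif: "is_uniformity X \<U>" and A: "A \<subseteq> X" "\<not> unif_totally_bounded X \<U> A"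
  obtains f :: "'a \<Rightarrow> real"
  where "continuous_map (uniform_topology X \<U>) euclideanreal f" "\<not> bounded (f ` A)"
    "\<And>B. unif_totally_bounded X \<U> B \<Longrightarrow> bounded (f ` B)"
proof -
  obtain U0 where U0: "U0 \<in> \<U>" "\<And>K. finite K \<Longrightarrow> K \<subseteq> X \<Longrightarrow> \<not> A \<subseteq> U0 `` K"
    using A unfolding totally_bounded_iff_finite_cover[OF unif] by meson
  obtain U where U: "U \<in> \<U>" "sym U" "U \<subseteq> U0"
    by (rule uniformity_symmetric_root[OF unif U0(1)]) blast
  have not_covered: "\<not> A \<subseteq> U `` K" if K: "finite K" "K \<subseteq> A" for K
  proof -
    have "U `` K \<subseteq> U0 `` K" using U(3) by blast
    then show ?thesis using U0(2)[of K] K A(1) by (meson order_trans)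
  qed
  have "\<exists>a. \<forall>n::nat. a n \<in> A \<and> (\<forall>i<n. (a i, a n) \<notin> U)"
    by (rule escaping_sequence, rule not_covered)
  then obtain a where "\<forall>n::nat. a n \<in> A \<and> (\<forall>i<n. (a i, a n) \<notin> U)" ..
  then have a: "\<And>n. a n \<in> A" "\<And>i n. i < n \<Longrightarrow> (a i, a n) \<notin> U"
    by (simp_all del: relpow.simps)
  have sep: "(a i, a j) \<notin> U" if "i \<noteq> j" for i j
    using that a(2) symD[OF U(2)] by (metis linorder_neqE_nat)
  obtain W where W: "W \<in> \<U>" "sym W" "W O W O W O W \<subseteq> U"
    by (rule uniformity_symmetric_fourth_root[OF unif U(1)]) blast
  have sepW: "(a i, a j) \<notin> W O W O W O W" if "i \<noteq> j" for i j
    using sep[OF that] W(3) by blast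
  have aX: "a n \<in> X" for n using a(1) A(1) by blast
  obtain f :: "'a \<Rightarrow> real" where f: "continuous_map (uniform_topology X \<U>) euclideanreal f"
      "\<And>n. f (a n) = real n" "\<And>B. finite {n. W `` {a n} \<inter> B \<noteq> {}} \<Longrightarrow> bounded (f ` B)"
    by (rule separated_sequence_unbounded_function[where a = a, OF unif W(1,2) aX sepW]) (assumption | rule that)+
  have "\<not> bounded (f ` A)"
    using a(1) f(2) by (rule not_bounded_image_if_values_nat)
  moreover have "bounded (f ` B)" if B: "unif_totally_bounded X \<U> B" for B
  proof -
    obtain K where "finite K" "B \<subseteq> W `` K"
      using B W(1) unfolding totally_bounded_iff_finite_cover[OF unif] by meson
    then have "finite {n. W `` {a n} \<inter> B \<noteq> {}}"
      by (rule finitely_many_meet[where N = 0]) (use sepW W(2) in \<open>auto simp: sym_conv_converse_eq\<close>)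
    then show ?thesis by (rule f(3))
  qed
  ultimately show thesis using that f(1) by blast
qed

text \<open>
  This is the analogue of the preceding lemma for Bourbaki bounded sets, on which the number
  \<open>m\<close> of steps from a finite set is not known in advance. This is why
  \<open>a\<^sub>n\<close> has to escape chains whose length grows with \<open>n\<close>: two bumps met
  by such a set can be joined by \<open>2m + 2\<close> steps, which is impossible for late terms.
\<close>

lemma unbounded_function_if_not_bourbaki_bounded:
  assumes unif: "is_uniformity X \<U>" and A: "A \<subseteq> X" "\<not> bourbaki_bounded X \<U> A"
  obtains f :: "'a \<Rightarrow> real"
  where "continuous_map (uniform_topology X \<U>) euclideanreal f" "\<not> bounded (f ` A)"
    "\<And>B. bourbaki_bounded X \<U> B \<Longrightarrow> bounded (f ` B)"
proof -
  obtain U0 where U0: "U0 \<in> \<U>" "\<And>(n::nat) K. finite K \<Longrightarrow> K \<subseteq> X \<Longrightarrow> \<not> A \<subseteq> (U0 ^^ n) `` K"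
    using A unfolding bourbaki_bounded_def by meson
  obtain U where U: "U \<in> \<U>" "sym U" "U \<subseteq> U0"
    by (rule uniformity_symmetric_root[OF unif U0(1)]) blast
  have not_covered: "\<not> A \<subseteq> (U ^^ Suc n) `` K" if K: "finite K" "K \<subseteq> A" for n K
  proof -
    have "(U ^^ Suc n) `` K \<subseteq> (U0 ^^ Suc n) `` K"
      using relpow_subset_relpow[OF U(3)] by (rule Image_mono) simp
    then show ?thesis using U0(2)[of K "Suc n"] K A(1) by (meson order_trans)
  qed
  have "\<exists>a. \<forall>n::nat. a n \<in> A \<and> (\<forall>i<n. (a i, a n) \<notin> U ^^ Suc n)"
    by (rule escaping_sequence, rule not_covered)
  then obtain a where "\<forall>n::nat. a n \<in> A \<and> (\<forall>i<n. (a i, a n) \<notin> U ^^ Suc n)" ..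
  then have a: "\<And>n. a n \<in> A" "\<And>i n. i < n \<Longrightarrow> (a i, a n) \<notin> U ^^ Suc n"
    by (simp_all del: relpow.simps)
  have aX: "a n \<in> X" for n using a(1) A(1) by blast
  have far: "(a i, a j) \<notin> U ^^ m" if "i < j" "m \<le> Suc j" for i j m
    using a(2)[OF that(1)] relpow_increasing[OF uniformity_refl[OF unif U(1)] _ that(2) aX] by blast
  have sep: "(a i, a j) \<notin> U" if "i \<noteq> j" for i j
    using that far[of _ _ 1] symD[OF U(2)] by (metis linorder_neqE_nat le_add1 plus_1_eq_Suc relpow_1)
  obtain W where W: "W \<in> \<U>" "sym W" "W \<subseteq> U" "W O W O W O W \<subseteq> U"
    by (rule uniformity_symmetric_fourth_root[OF unif U(1)]) blast
  have sepW: "(a i, a j) \<notin> W O W O W O W" if "i \<noteq> j" for i j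
    using sep[OF that] W(4) by blast
  obtain f :: "'a \<Rightarrow> real" where f: "continuous_map (uniform_topology X \<U>) euclideanreal f"
      "\<And>n. f (a n) = real n" "\<And>B. finite {n. W `` {a n} \<inter> B \<noteq> {}} \<Longrightarrow> bounded (f ` B)"
    by (rule separated_sequence_unbounded_function[where a = a, OF unif W(1,2) aX sepW]) (assumption | rule that)+
  have "\<not> bounded (f ` A)"
    using a(1) f(2) by (rule not_bounded_image_if_values_nat)
  moreover have "bounded (f ` B)" if B: "bourbaki_bounded X \<U> B" for B
  proof -
    obtain m K where K: "finite K" "B \<subseteq> (U ^^ m) `` K"
      using B U(1) unfolding bourbaki_bounded_def by meson
    have "finite {n. W `` {a n} \<inter> B \<noteq> {}}"
    \<comment> \<open>For \<open>j > 2m + 1\<close> the joining chain has \<open>2m + 2 \<le> j + 1\<close> steps.\<close>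
    proof (rule finitely_many_meet[OF K, where N = "2 * m + 1"])
      fix i j assume ij: "2 * m + 1 \<le> i" "i < j"
      have "W O (U ^^ m)\<inverse> O U ^^ m O W\<inverse> \<subseteq> U ^^ 1 O U ^^ m O U ^^ m O U ^^ 1"
        using W(2,3) sym_relpow[OF U(2), of m]
        by (intro relcomp_mono) (auto simp: sym_conv_converse_eq)
      also have "\<dots> = U ^^ (1 + (m + (m + 1)))"
        by (simp only: relpow_add)
      finally show "(a i, a j) \<notin> W O (U ^^ m)\<inverse> O U ^^ m O W\<inverse>"
        using far[of i j "1 + (m + (m + 1))"] ij by auto
    qed
    then show ?thesis by (rule f(3))
  qed
  ultimately show thesis using that f(1) by blast
qed

section \<open>The weak uniformity of a family of functions\<close>

definition weak_entourage :: "'a set \<Rightarrow> ('a \<Rightarrow> real) set \<Rightarrow> real \<Rightarrow> ('a \<times> 'a) set" where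
  "weak_entourage X G \<epsilon> = {(x, y) \<in> X \<times> X. \<forall>f\<in>G. \<bar>f x - f y\<bar> < \<epsilon>}"

text \<open>
  The coarsest uniformity on \<open>X\<close> that makes all functions in \<open>F\<close> uniformly
  continuous; using one \<open>\<epsilon>\<close> for the whole finite subfamily loses nothing.
\<close>

definition weak_uniformity :: "'a set \<Rightarrow> ('a \<Rightarrow> real) set \<Rightarrow> ('a \<times> 'a) set set" where
  "weak_uniformity X F =
    {E. E \<subseteq> X \<times> X \<and> (\<exists>G \<epsilon>. finite G \<and> G \<subseteq> F \<and> \<epsilon> > 0 \<and> weak_entourage X G \<epsilon> \<subseteq> E)}"

lemma weak_entourage_mem:
  assumes "finite G" "G \<subseteq> F" "\<epsilon> > 0"
  shows "weak_entourage X G \<epsilon> \<in> weak_uniformity X F"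
  using assms by (fastforce simp: weak_uniformity_def weak_entourage_def)

lemma is_uniformity_weak_uniformity: "is_uniformity X (weak_uniformity X F)"
proof -
  have E: "\<exists>G \<epsilon>. finite G \<and> G \<subseteq> F \<and> \<epsilon> > 0 \<and> weak_entourage X G \<epsilon> \<subseteq> U" "U \<subseteq> X \<times> X"
    if "U \<in> weak_uniformity X F" for U
    using that by (auto simp: weak_uniformity_def)
  show ?thesis
    unfolding is_uniformity_def
  proof (intro conjI ballI allI impI)
    show "weak_uniformity X F \<noteq> {}"
      using weak_entourage_mem[of "{}" F 1 X] by auto
    show "weak_uniformity X F \<subseteq> Pow (X \<times> X)" using E(2) by blast
  next
    fix U V assume U: "U \<in> weak_uniformity X F" and V: "U \<subseteq> V \<and> V \<subseteq> X \<times> X"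
    then show "V \<in> weak_uniformity X F"
      unfolding weak_uniformity_def by (blast intro: order_trans)
  next
    fix U V assume UV: "U \<in> weak_uniformity X F" "V \<in> weak_uniformity X F"
    obtain G \<epsilon> where G: "finite G" "G \<subseteq> F" "\<epsilon> > 0" "weak_entourage X G \<epsilon> \<subseteq> U" using E(1)[OF UV(1)] by blast
    obtain H \<delta> where H: "finite H" "H \<subseteq> F" "\<delta> > 0" "weak_entourage X H \<delta> \<subseteq> V" using E(1)[OF UV(2)] by blast
    have "weak_entourage X (G \<union> H) (min \<epsilon> \<delta>) \<subseteq> weak_entourage X G \<epsilon> \<inter> weak_entourage X H \<delta>"
      by (auto simp: weak_entourage_def)
    then have "weak_entourage X (G \<union> H) (min \<epsilon> \<delta>) \<subseteq> U \<inter> V" using G(4) H(4) by blast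
    then show "U \<inter> V \<in> weak_uniformity X F"
      unfolding weak_uniformity_def using E(2)[OF UV(1)] G H
      by (intro CollectI conjI exI[of _ "G \<union> H"] exI[of _ "min \<epsilon> \<delta>"]) auto
  next
    fix U assume U: "U \<in> weak_uniformity X F"
    obtain G \<epsilon> where G: "finite G" "G \<subseteq> F" "\<epsilon> > 0" "weak_entourage X G \<epsilon> \<subseteq> U" using E(1)[OF U] by blast
    have "Id_on X \<subseteq> weak_entourage X G \<epsilon>" using G(3) by (auto simp: weak_entourage_def)
    then show "Id_on X \<subseteq> U" using G(4) by blast
    have "weak_entourage X G \<epsilon> \<subseteq> (weak_entourage X G \<epsilon>)\<inverse>"
      by (auto simp: weak_entourage_def abs_minus_commute)
    then have "weak_entourage X G \<epsilon> \<subseteq> U\<inverse>" using G(4) by blast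
    then show "U\<inverse> \<in> weak_uniformity X F"
      unfolding weak_uniformity_def using G E(2)[OF U] by blast
    have "weak_entourage X G (\<epsilon>/2) O weak_entourage X G (\<epsilon>/2) \<subseteq> weak_entourage X G \<epsilon>"
    proof
      fix p assume "p \<in> weak_entourage X G (\<epsilon>/2) O weak_entourage X G (\<epsilon>/2)"
      then obtain x y z where p: "p = (x, z)" "(x, y) \<in> weak_entourage X G (\<epsilon>/2)"
        "(y, z) \<in> weak_entourage X G (\<epsilon>/2)" by blast
      have "\<bar>f x - f z\<bar> < \<epsilon>" if "f \<in> G" for f
      proof -
        have "\<bar>f x - f y\<bar> < \<epsilon>/2" "\<bar>f y - f z\<bar> < \<epsilon>/2"
          using p that by (auto simp: weak_entourage_def)
        then show ?thesis by linarith
      qed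
      then show "p \<in> weak_entourage X G \<epsilon>"
        using p by (auto simp: weak_entourage_def)
    qed
    then show "\<exists>V\<in>weak_uniformity X F. V O V \<subseteq> U"
      using G weak_entourage_mem[of G F "\<epsilon>/2" X] by (meson half_gt_zero order_trans)
  qed
qed

text \<open>
  Continuity of the functions makes the weak topology coarser than \<open>T\<close>; the second
  hypothesis, that single functions already detect neighbourhoods, makes it finer.
\<close>

lemma uniform_topology_weak_uniformity:
  assumes cont: "\<And>f. f \<in> F \<Longrightarrow> continuous_map T euclideanreal f"
    and sep: "\<And>S x. openin T S \<Longrightarrow> x \<in> S \<Longrightarrow>
      \<exists>f\<in>F. \<exists>\<epsilon>>0. \<forall>y\<in>topspace T. \<bar>f x - f y\<bar> < \<epsilon> \<longrightarrow> y \<in> S"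
  shows "uniform_topology (topspace T) (weak_uniformity (topspace T) F) = T"
proof (rule topology_eq[THEN iffD2], rule allI)
  fix S
  let ?X = "topspace T"
  have "openin T S" if S: "S \<subseteq> ?X" "\<And>x. x \<in> S \<Longrightarrow> \<exists>U\<in>weak_uniformity ?X F. U `` {x} \<subseteq> S"
  proof (subst openin_subopen, intro ballI)
    fix x assume x: "x \<in> S"
    obtain G \<epsilon> where G: "finite G" "G \<subseteq> F" "\<epsilon> > 0" "weak_entourage ?X G \<epsilon> `` {x} \<subseteq> S"
      using S(2)[OF x] by (fastforce simp: weak_uniformity_def)
    let ?N = "\<Inter> (insert ?X ((\<lambda>f. {y \<in> ?X. f y \<in> ball (f x) \<epsilon>}) ` G))"
    have "openin T ?N"
    proof (rule openin_Inter)
      fix N assume "N \<in> insert ?X ((\<lambda>f. {y \<in> ?X. f y \<in> ball (f x) \<epsilon>}) ` G)"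
      then show "openin T N"
        using G(2) cont by (auto simp del: mem_ball intro!: openin_continuous_map_preimage)
    qed (use G(1) in auto)
    moreover have "x \<in> ?N" using x S(1) G(3) by auto
    moreover have "?N \<subseteq> S"
      using G(4) x S(1) by (auto simp: weak_entourage_def dist_real_def)
    ultimately show "\<exists>N. openin T N \<and> x \<in> N \<and> N \<subseteq> S" by blast
  qed
  moreover have "S \<subseteq> ?X \<and> (\<forall>x\<in>S. \<exists>U\<in>weak_uniformity ?X F. U `` {x} \<subseteq> S)" if S: "openin T S"
  proof (intro conjI ballI)
    show "S \<subseteq> ?X" using S by (rule openin_subset)
    fix x assume "x \<in> S"
    then obtain f \<epsilon> where f: "f \<in> F" "\<epsilon> > 0" "\<And>y. y \<in> ?X \<Longrightarrow> \<bar>f x - f y\<bar> < \<epsilon> \<Longrightarrow> y \<in> S"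
      using sep[OF S] by blast
    then have "weak_entourage ?X {f} \<epsilon> `` {x} \<subseteq> S" by (auto simp: weak_entourage_def)
    then show "\<exists>U\<in>weak_uniformity ?X F. U `` {x} \<subseteq> S"
      using weak_entourage_mem[of "{f}" F \<epsilon> ?X] f by blast
  qed
  ultimately show "openin (uniform_topology ?X (weak_uniformity ?X F)) S \<longleftrightarrow> openin T S"
    unfolding openin_uniform_topology[OF is_uniformity_weak_uniformity] by blast
qed

text \<open>
  Rounding the values of the finitely many functions in \<open>G\<close> down to multiples of
  \<open>\<epsilon>\<close> takes only finitely many values on \<open>B\<close>, and points with equal
  rounded values are close.
\<close>

lemma totally_bounded_weak_uniformity:
  assumes "B \<subseteq> X" and bdd: "\<And>f. f \<in> F \<Longrightarrow> bounded (f ` B)"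
  shows "unif_totally_bounded X (weak_uniformity X F) B"
  unfolding unif_totally_bounded_def
proof (intro conjI ballI)
  fix U assume "U \<in> weak_uniformity X F"
  then obtain G \<epsilon> where G: "finite G" "G \<subseteq> F" "\<epsilon> > 0" "weak_entourage X G \<epsilon> \<subseteq> U"
    by (auto simp: weak_uniformity_def)
  define h where "h x = restrict (\<lambda>f. \<lfloor>f x / \<epsilon>\<rfloor>) G" for x
  show "\<exists>P. finite P \<and> partition_on B P \<and> (\<forall>C\<in>P. C \<times> C \<subseteq> U)"
  proof (rule finite_partition_by_function)
    have "finite ((\<lambda>x. \<lfloor>f x / \<epsilon>\<rfloor>) ` B)" if "f \<in> G" for f
    proof -
      obtain c where c: "\<And>x. x \<in> B \<Longrightarrow> \<bar>f x\<bar> \<le> c"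
        using bdd[of f] \<open>f \<in> G\<close> G(2) unfolding bounded_iff by auto
      have "(\<lambda>x. \<lfloor>f x / \<epsilon>\<rfloor>) ` B \<subseteq> {\<lfloor>- c / \<epsilon>\<rfloor>..\<lfloor>c / \<epsilon>\<rfloor>}"
      proof (clarsimp, intro conjI floor_mono)
        fix x assume "x \<in> B"
        then have "- c \<le> f x" "f x \<le> c" using c by force+
        then show "- (c / \<epsilon>) \<le> f x / \<epsilon>" "f x / \<epsilon> \<le> c / \<epsilon>"
          using G(3) by (auto simp: field_simps)
      qed
      then show ?thesis by (rule finite_subset) simp
    qed
    then have "finite (PiE G (\<lambda>f. (\<lambda>x. \<lfloor>f x / \<epsilon>\<rfloor>) ` B))"
      using G(1) by (intro finite_PiE)
    moreover have "h ` B \<subseteq> PiE G (\<lambda>f. (\<lambda>x. \<lfloor>f x / \<epsilon>\<rfloor>) ` B)"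
      by (auto simp: h_def)
    ultimately show "finite (h ` B)" by (rule finite_subset[rotated])
  next
    fix x y assume xy: "x \<in> B" "y \<in> B" "h x = h y"
    have "\<bar>f x - f y\<bar> < \<epsilon>" if "f \<in> G" for f
    proof -
      have "\<lfloor>f x / \<epsilon>\<rfloor> = \<lfloor>f y / \<epsilon>\<rfloor>"
        using fun_cong[OF xy(3), of f] that by (simp add: h_def)
      then have "\<bar>f x / \<epsilon> - f y / \<epsilon>\<bar> < 1" by linarith
      then have "\<bar>f x - f y\<bar> / \<epsilon> < 1" using G(3) by (simp flip: diff_divide_distrib)
      then show ?thesis using G(3) by simp
    qed
    then show "(x, y) \<in> U"
      using G(4) xy(1,2) assms(1) by (auto simp: weak_entourage_def)
  qed
qed (rule assms(1))

lemma totally_bounded_imp_bourbaki_bounded: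
  assumes unif: "is_uniformity X \<U>" and B: "unif_totally_bounded X \<U> B"
  shows "bourbaki_bounded X \<U> B"
  using B unfolding totally_bounded_iff_finite_cover[OF unif] bourbaki_bounded_def
  by (metis relpow_1)

lemma bourbaki_bounded_weak_uniformity_imp_bounded:
  assumes B: "bourbaki_bounded X (weak_uniformity X F) B" and f: "f \<in> F"
  shows "bounded (f ` B)"
proof -
  let ?U = "weak_entourage X {f} 1"
  obtain n :: nat and K where K: "finite K" "B \<subseteq> (?U ^^ n) `` K"
    using B weak_entourage_mem[of "{f}" F 1 X] f unfolding bourbaki_bounded_def by auto
  have step: "\<bar>f y\<bar> \<le> \<bar>f x\<bar> + real m" if "(x, y) \<in> ?U ^^ m" for x y m
    using that
  proof (induction m arbitrary: y)
    case (Suc m)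
    then obtain z where "(x, z) \<in> ?U ^^ m" "(z, y) \<in> ?U" by auto
    then have "\<bar>f z\<bar> \<le> \<bar>f x\<bar> + real m" "\<bar>f z - f y\<bar> < 1"
      using Suc.IH by (auto simp: weak_entourage_def)
    then show ?case by linarith
  qed simp
  have "bounded (f ` K)" using K(1) by (simp add: finite_imp_bounded)
  then obtain c where c: "\<And>k. k \<in> K \<Longrightarrow> \<bar>f k\<bar> \<le> c" unfolding bounded_iff by auto
  have "\<bar>f y\<bar> \<le> c + real n" if y: "y \<in> B" for y
  proof -
    obtain k where "k \<in> K" "(k, y) \<in> ?U ^^ n" using K(2) y by blast
    then show ?thesis using step[of k y n] c[of k] by linarith
  qed
  then show ?thesis by (intro boundedI[of _ "c + real n"]) auto
qed

section \<open>Bornologies of uniformities are functionally determined\<close>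

text \<open>
  The second condition says that \<open>T\<close> is no finer than the weak topology of
  \<open>F\<close>. It asks for single functions instead of finite subfamilies; Urysohn
  functions provide this.
\<close>

definition functionally_determined :: "'a topology \<Rightarrow> 'a set set \<Rightarrow> bool" where
  "functionally_determined T \<B> \<longleftrightarrow> (\<exists>F.
     (\<forall>f\<in>F. continuous_map T euclideanreal f) \<and>
     (\<forall>S x. openin T S \<longrightarrow> x \<in> S \<longrightarrow>
        (\<exists>f\<in>F. \<exists>\<epsilon>>0. \<forall>y\<in>topspace T. \<bar>f x - f y\<bar> < \<epsilon> \<longrightarrow> y \<in> S)) \<and>
     \<B> = {B. B \<subseteq> topspace T \<and> (\<forall>f\<in>F. bounded (f ` B))})"

text \<open>
  In the weak uniformity of \<open>F\<close> total boundedness, Bourbaki boundedness and boundedness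
  of all functions in \<open>F\<close> coincide, since each implies the next and the last implies the
  first.
\<close>

lemma functionally_determined_imp_uniformizable:
  assumes "functionally_determined T \<B>"
  shows "bb_uniformizable T \<B>" "tb_uniformizable T \<B>"
proof -
  obtain F :: "('a \<Rightarrow> real) set" where F: "\<forall>f\<in>F. continuous_map T euclideanreal f"
      "\<forall>S x. openin T S \<longrightarrow> x \<in> S \<longrightarrow>
        (\<exists>f\<in>F. \<exists>\<epsilon>>0. \<forall>y\<in>topspace T. \<bar>f x - f y\<bar> < \<epsilon> \<longrightarrow> y \<in> S)"
      "\<B> = {B. B \<subseteq> topspace T \<and> (\<forall>f\<in>F. bounded (f ` B))}"
    using assms unfolding functionally_determined_def by (elim exE conjE) (rule that)
  let ?X = "topspace T" let ?\<U> = "weak_uniformity ?X F"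
  have unif: "is_uniformity ?X ?\<U>" by (rule is_uniformity_weak_uniformity)
  have top: "uniform_topology ?X ?\<U> = T"
    by (rule uniform_topology_weak_uniformity) (simp_all add: F(1,2))
  have "bourbaki_bounded ?X ?\<U> B \<Longrightarrow> B \<in> \<B>" for B
    using bourbaki_bounded_weak_uniformity_imp_bounded[of ?X F B]
    by (auto simp: F(3) bourbaki_bounded_def)
  moreover have "B \<in> \<B> \<Longrightarrow> unif_totally_bounded ?X ?\<U> B" for B
    using totally_bounded_weak_uniformity[of B ?X F] by (auto simp: F(3))
  ultimately have "\<B> = {B. bourbaki_bounded ?X ?\<U> B}" "\<B> = {B. unif_totally_bounded ?X ?\<U> B}"
    using totally_bounded_imp_bourbaki_bounded[OF unif] by blast+
  then show "bb_uniformizable T \<B>" "tb_uniformizable T \<B>"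
    unfolding bb_uniformizable_def tb_uniformizable_def using unif top by blast+
qed

text \<open>
  The witness is the largest possible family: all continuous functions bounded on every
  member of \<open>\<B>\<close>. It contains all bounded continuous functions, so it induces the
  topology whatever \<open>\<B>\<close> is.
\<close>

lemma functionally_determinedI:
  assumes unif: "is_uniformity X \<U>" and sub: "\<B> \<subseteq> Pow X"
    and unb: "\<And>A. A \<subseteq> X \<Longrightarrow> A \<notin> \<B> \<Longrightarrow>
      \<exists>f :: 'a \<Rightarrow> real. continuous_map (uniform_topology X \<U>) euclideanreal f \<and>
        \<not> bounded (f ` A) \<and> (\<forall>B\<in>\<B>. bounded (f ` B))"
  shows "functionally_determined (uniform_topology X \<U>) \<B>"
  unfolding functionally_determined_def topspace_uniform_topology[OF unif]
proof (intro exI conjI ballI allI impI)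
  let ?F = "{f :: 'a \<Rightarrow> real. continuous_map (uniform_topology X \<U>) euclideanreal f \<and>
    (\<forall>B\<in>\<B>. bounded (f ` B))}"
  show "continuous_map (uniform_topology X \<U>) euclideanreal f" if "f \<in> ?F" for f
    using that by blast
  show "\<exists>f\<in>?F. \<exists>\<epsilon>>0. \<forall>y\<in>X. \<bar>f x - f y\<bar> < \<epsilon> \<longrightarrow> y \<in> S"
    if S: "openin (uniform_topology X \<U>) S" "x \<in> S" for S x
  proof -
    obtain U where U: "U \<in> \<U>" "U `` {x} \<subseteq> S" "x \<in> X"
      using S unfolding openin_uniform_topology[OF unif] by blast
    obtain f where f: "continuous_map (uniform_topology X \<U>) euclideanreal f"
        "\<And>y. 0 \<le> f y" "\<And>y. f y \<le> 1" "\<And>y. y \<in> {x} \<Longrightarrow> f y = (0::real)" "\<And>y. y \<notin> U `` {x} \<Longrightarrow> f y = 1"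
      using uniform_Urysohn[OF unif U(1), of "{x}"] U(3) by blast
    have "bounded (f ` B)" for B
      by (rule boundedI[of _ 1]) (use f(2,3) in auto)
    then have "f \<in> ?F" using f(1) by blast
    moreover have "\<forall>y\<in>X. \<bar>f x - f y\<bar> < 1 \<longrightarrow> y \<in> S"
      using f(4)[of x] f(5) U(2) by fastforce
    ultimately show ?thesis by (intro bexI[of _ f] exI[of _ 1]) auto
  qed
  show "\<B> = {B. B \<subseteq> X \<and> (\<forall>f\<in>?F. bounded (f ` B))}"
  proof (intro subset_antisym subsetI)
    fix B assume "B \<in> \<B>"
    then show "B \<in> {B. B \<subseteq> X \<and> (\<forall>f\<in>?F. bounded (f ` B))}" using sub by auto
  next
    fix A assume A: "A \<in> {B. B \<subseteq> X \<and> (\<forall>f\<in>?F. bounded (f ` B))}"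
    then have "A \<subseteq> X" by simp
    then show "A \<in> \<B>" using unb[of A] A by auto
  qed
qed

lemma bb_uniformizable_iff_functionally_determined:
  "bb_uniformizable T \<B> \<longleftrightarrow> functionally_determined T \<B>"
proof
  assume "bb_uniformizable T \<B>"
  then obtain \<U> where unif: "is_uniformity (topspace T) \<U>"
    and T: "uniform_topology (topspace T) \<U> = T"
    and \<B>: "\<B> = {B. bourbaki_bounded (topspace T) \<U> B}"
    unfolding bb_uniformizable_def by blast
  have "functionally_determined (uniform_topology (topspace T) \<U>) \<B>"
  proof (rule functionally_determinedI[OF unif])
    show "\<B> \<subseteq> Pow (topspace T)" by (auto simp: \<B> bourbaki_bounded_def)
  next
    fix A assume A: "A \<subseteq> topspace T" "A \<notin> \<B>"
    then have not_bdd: "\<not> bourbaki_bounded (topspace T) \<U> A" by (simp add: \<B>)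
    obtain f :: "'a \<Rightarrow> real"
      where "continuous_map (uniform_topology (topspace T) \<U>) euclideanreal f"
        "\<not> bounded (f ` A)" "\<And>B. bourbaki_bounded (topspace T) \<U> B \<Longrightarrow> bounded (f ` B)"
      by (rule unbounded_function_if_not_bourbaki_bounded[OF unif A(1) not_bdd]) (rule that)
    then show "\<exists>f :: 'a \<Rightarrow> real. continuous_map (uniform_topology (topspace T) \<U>) euclideanreal f \<and>
        \<not> bounded (f ` A) \<and> (\<forall>B\<in>\<B>. bounded (f ` B))"
      by (auto simp: \<B>)
  qed
  then show "functionally_determined T \<B>" by (simp add: T)
qed (rule functionally_determined_imp_uniformizable)

lemma tb_uniformizable_iff_functionally_determined:
  "tb_uniformizable T \<B> \<longleftrightarrow> functionally_determined T \<B>"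
proof
  assume "tb_uniformizable T \<B>"
  then obtain \<U> where unif: "is_uniformity (topspace T) \<U>"
    and T: "uniform_topology (topspace T) \<U> = T"
    and \<B>: "\<B> = {B. unif_totally_bounded (topspace T) \<U> B}"
    unfolding tb_uniformizable_def by blast
  have "functionally_determined (uniform_topology (topspace T) \<U>) \<B>"
  proof (rule functionally_determinedI[OF unif])
    show "\<B> \<subseteq> Pow (topspace T)" by (auto simp: \<B> unif_totally_bounded_def)
  next
    fix A assume A: "A \<subseteq> topspace T" "A \<notin> \<B>"
    then have not_bdd: "\<not> unif_totally_bounded (topspace T) \<U> A" by (simp add: \<B>)
    obtain f :: "'a \<Rightarrow> real"
      where "continuous_map (uniform_topology (topspace T) \<U>) euclideanreal f"
        "\<not> bounded (f ` A)" "\<And>B. unif_totally_bounded (topspace T) \<U> B \<Longrightarrow> bounded (f ` B)"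
      by (rule unbounded_function_if_not_totally_bounded[OF unif A(1) not_bdd]) (rule that)
    then show "\<exists>f :: 'a \<Rightarrow> real. continuous_map (uniform_topology (topspace T) \<U>) euclideanreal f \<and>
        \<not> bounded (f ` A) \<and> (\<forall>B\<in>\<B>. bounded (f ` B))"
      by (auto simp: \<B>)
  qed
  then show "functionally_determined T \<B>" by (simp add: T)
qed (rule functionally_determined_imp_uniformizable)

theorem proposition10:
  fixes T :: "'a topology" and \<B> :: "'a set set"
  assumes "bornological_universe T \<B>"
  shows "bb_uniformizable T \<B> \<longleftrightarrow> tb_uniformizable T \<B>"
  by (simp add: bb_uniformizable_iff_functionally_determined
      tb_uniformizable_iff_functionally_determined)

end
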